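(* Let $h:\mathbb{R}^d\times\Lambda\to\mathbb{R}$, the distribution $\mathbb{P}_\lambda$ on $\Lambda$, and the basis $\Phi(\lambda)\in\mathbb{R}^{d\times p}$ be as in the context. Assume: (1) there are constants $0<\mu\le L$ such that for all $\lambda\in\Lambda$ the function $h(\cdot,\lambda)$ is $\mu$-strongly convex and $L$-smooth; (2) there is no $\beta\in\mathbb{R}^p$, $\beta\neq0$, with $\Phi(\tilde\lambda)\beta=0$ for $\mathbb{P}_\lambda$-almost every $\tilde\lambda$. Define $f(\beta,\lambda):=h(\Phi(\lambda)\beta,\lambda)$ and $F(\beta):=\mathbb{E}_{\tilde\lambda\sim\mathbb{P}_\lambda}[f(\beta,\tilde\lambda)]$ for $\beta\in\mathbb{R}^p$, and $F^*:=\min_{\beta\in\mathbb{R}^p}F(\beta)$. Then $f$ and $F$ satisfy the relaxed weak growth condition with constants $\rho=CL$ and $\sigma^2=2CL\epsilon^*_{\rm sp}$, i.e., for all $\beta\in\mathbb{R}^p$, $$\mathbb{E}_{\tilde\lambda\sim\mathbb{P}_\lambda}\left[\|\nabla_\beta f(\beta,\tilde\lambda)\|^2\right]\ \le\ 2CL\,(F(\beta)-F^* )+2CL\,\epsilon^*_{\rm sp}.$$ In addition, $F$ is $c\mu$-strongly convex.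
   Context: $\|\cdot\|$ is the Euclidean norm. $\Lambda$ is an arbitrary set of parameters carrying a probability distribution $\mathbb{P}_\lambda$. $h:\mathbb{R}^d\times\Lambda\to\mathbb{R}$ is such that for each $\lambda\in\Lambda$ the problem $\min_{\theta\in\mathbb{R}^d}h(\theta,\lambda)$ admits an optimal solution, denoted $\theta^*(\lambda)$. "$h(\cdot,\lambda)$ is $\mu$-strongly convex and $L$-smooth" means: for all $\theta,\bar\theta\in\mathbb{R}^d$, $\frac{\mu}{2}\|\theta-\bar\theta\|^2\le h(\theta,\lambda)-h(\bar\theta,\lambda)-\nabla_\theta h(\bar\theta,\lambda)^\top(\theta-\bar\theta)\le\frac{L}{2}\|\theta-\bar\theta\|^2$. Basis functions: $\Phi_j:\Lambda\to\mathbb{R}^d$, $j=1,\dots,p$, and $\Phi(\lambda)\in\mathbb{R}^{d\times p}$ is the matrix with columns $\Phi_j(\lambda)$. All functions are measurable in $\lambda$ as needed and all expectations over $\tilde\lambda\sim\mathbb{P}_\lambda$ are well defined and finite. Solution path error of $\beta\in\mathbb{R}^p$: $\epsilon_{\rm sp}(\beta):=\sup_{\lambda\in\Lambda}\{h(\Phi(\lambda)\beta,\lambda)-h(\theta^*(\lambda),\lambda)\}$; $\epsilon_{\rm sp}^*:=\inf_{\beta\in\mathbb{R}^p}\epsilon_{\rm sp}(\beta)$. Constants (finite): $C:=\sup_{\lambda\in\Lambda}\sigma_{\max}(\Phi(\lambda)^\top\Phi(\lambda))$ (largest eigenvalue) and $c:=\sigma_{\min}(\mathbb{E}_{\tilde\lambda\sim\mathbb{P}_\lambda}[\Phi(\tilde\lambda)^\top\Phi(\tilde\lambda)])$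 (smallest eigenvalue). Relaxed weak growth condition: a family $g(\cdot,z):\mathbb{R}^p\to\mathbb{R}$, $z\sim\mathbb{P}_z$, and $G:=\mathbb{E}_z[g(\cdot,z)]$ with minimum value $G^*$ satisfy it with constants $\rho,\sigma\ge0$ if $\mathbb{E}_z[\|\nabla g(w,z)\|^2]\le2\rho(G(w)-G^* )+\sigma^2$ for all $w\in\mathbb{R}^p$. *)

theory Defs
  imports "HOL-Probability.Probability"
begin

definition grad :: "('a::real_inner \<Rightarrow> real) \<Rightarrow> 'a \<Rightarrow> 'a" where
  "grad f x = (THE D. GDERIV f x :> D)"

text \<open>Differentiability is stated explicitly because \<^const>\<open>grad\<close> is only meaningful where the
  gradient exists.\<close>

definition strongly_convex :: "real \<Rightarrow> ('a::real_inner \<Rightarrow> real) \<Rightarrow> bool" where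
  "strongly_convex \<mu> f \<longleftrightarrow>
     (\<forall>x. f differentiable (at x)) \<and>
     (\<forall>x y. \<mu> / 2 * (norm (x - y))\<^sup>2 \<le> f x - f y - grad f y \<bullet> (x - y))"

definition smooth_with :: "real \<Rightarrow> ('a::real_inner \<Rightarrow> real) \<Rightarrow> bool" where
  "smooth_with L f \<longleftrightarrow>
     (\<forall>x. f differentiable (at x)) \<and>
     (\<forall>x y. f x - f y - grad f y \<bullet> (x - y) \<le> L / 2 * (norm (x - y))\<^sup>2)"

definition eigenvals :: "real^'n^'n \<Rightarrow> real set" where
  "eigenvals A = {k. \<exists>v. v \<noteq> 0 \<and> A *v v = k *\<^sub>R v}"

text \<open>Only applied to symmetric matrices, whose set of real eigenvalues is finite and nonempty.\<close>

definition sigma_max :: "real^'n^'n \<Rightarrow> real" where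
  "sigma_max A = Max (eigenvals A)"

definition sigma_min :: "real^'n^'n \<Rightarrow> real" where
  "sigma_min A = Min (eigenvals A)"

text \<open>The \<open>d \<times> p\<close> matrix with columns \<open>\<phi> j l\<close>.\<close>

definition basis_matrix :: "('p::finite \<Rightarrow> 'l \<Rightarrow> real^'d) \<Rightarrow> 'l \<Rightarrow> real^'p^'d" where
  "basis_matrix \<phi> l = (\<chi> i j. \<phi> j l $ i)"

definition gram :: "('p::finite \<Rightarrow> 'l \<Rightarrow> real^'d) \<Rightarrow> 'l \<Rightarrow> real^'p^'p" where
  "gram \<phi> l = transpose (basis_matrix \<phi> l) ** basis_matrix \<phi> l"

text \<open>Below, the parameter set is the space of the probability measure. The constant
  \<open>C_const\<close> is a supremum in the reals, so it is meaningful only for a bounded family.\<close>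

definition C_const :: "'l measure \<Rightarrow> ('p::finite \<Rightarrow> 'l \<Rightarrow> real^'d) \<Rightarrow> real" where
  "C_const P \<phi> = (SUP l\<in>space P. sigma_max (gram \<phi> l))"

definition c_const :: "'l measure \<Rightarrow> ('p::finite \<Rightarrow> 'l \<Rightarrow> real^'d) \<Rightarrow> real" where
  "c_const P \<phi> = sigma_min (\<integral>l. gram \<phi> l \<partial>P)"

definition path_obj ::
  "(real^'d \<Rightarrow> 'l \<Rightarrow> real) \<Rightarrow> ('p::finite \<Rightarrow> 'l \<Rightarrow> real^'d) \<Rightarrow> real^'p \<Rightarrow> 'l \<Rightarrow> real" where
  "path_obj h \<phi> \<beta> l = h (basis_matrix \<phi> l *v \<beta>) l"

text \<open>The solution path error may be infinite, hence the extended reals.\<close>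

definition eps_sp ::
  "'l measure \<Rightarrow> (real^'d \<Rightarrow> 'l \<Rightarrow> real) \<Rightarrow> ('l \<Rightarrow> real^'d) \<Rightarrow>
    ('p::finite \<Rightarrow> 'l \<Rightarrow> real^'d) \<Rightarrow> real^'p \<Rightarrow> ereal" where
  "eps_sp P h \<theta>opt \<phi> \<beta> =
     (SUP l\<in>space P. ereal (h (basis_matrix \<phi> l *v \<beta>) l - h (\<theta>opt l) l))"

definition eps_sp_opt ::
  "'l measure \<Rightarrow> (real^'d \<Rightarrow> 'l \<Rightarrow> real) \<Rightarrow> ('l \<Rightarrow> real^'d) \<Rightarrow>
    ('p::finite \<Rightarrow> 'l \<Rightarrow> real^'d) \<Rightarrow> ereal" where
  "eps_sp_opt P h \<theta>opt \<phi> = (INF \<beta>. eps_sp P h \<theta>opt \<phi> \<beta>)"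

definition expected_obj :: "'z measure \<Rightarrow> ('w \<Rightarrow> 'z \<Rightarrow> real) \<Rightarrow> 'w \<Rightarrow> real" where
  "expected_obj P g w = (\<integral>z. g w z \<partial>P)"

text \<open>The last argument is the constant \<open>\<sigma>\<^sup>2\<close>, which may be infinite. The expectation of the squared
  gradient norm is a nonnegative integral with values in \<open>[0, \<infinity>]\<close>. The point \<open>w0\<close> is a minimiser,
  so that \<open>expected_obj P g w0\<close> is the minimum value of the expected objective; that the minimum is
  attained is part of the condition.\<close>

definition relaxed_weak_growth ::
  "'z measure \<Rightarrow> ('w::real_inner \<Rightarrow> 'z \<Rightarrow> real) \<Rightarrow> real \<Rightarrow> ereal \<Rightarrow> bool" where
  "relaxed_weak_growth P g \<rho> \<sigma>sq \<longleftrightarrow>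
     0 \<le> \<rho> \<and> 0 \<le> \<sigma>sq \<and>
     (\<exists>w0. (\<forall>w. expected_obj P g w0 \<le> expected_obj P g w) \<and>
       (\<forall>w. enn2ereal (\<integral>\<^sup>+ z. ennreal ((norm (grad (\<lambda>v. g v z) w))\<^sup>2) \<partial>P)
              \<le> ereal (2 * \<rho> * (expected_obj P g w - expected_obj P g w0)) + \<sigma>sq))"

end

theory Submission
  imports Defs
begin

text \<open>Each \<open>f(\<cdot>, l)\<close> is \<open>CL\<close>-smooth and bounded below by \<open>h(\<theta>opt l, l)\<close>, so one gradient step
  from \<open>\<beta>\<close> shows that its squared gradient at \<open>\<beta>\<close> is at most \<open>2CL (f(\<beta>, l) - h(\<theta>opt l, l))\<close>, hence
  at most \<open>2CL (f(\<beta>, l) - f(\<beta>', l) + \<epsilon>\<^sub>s\<^sub>p(\<beta>'))\<close> for every \<open>\<beta>'\<close>. Integrating and then taking the infimum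
  over \<open>\<beta>'\<close> gives the growth condition without any measurability of the optimal values. Strong
  convexity of \<open>F\<close> comes from integrating the lower bound \<open>\<mu>/2 \<parallel>\<Phi>(l)v\<parallel>\<^sup>2\<close>, where assumption (2) makes the
  expected Gram matrix positive definite; so \<open>F\<close> is coercive and attains its minimum.\<close>

section \<open>Gradients\<close>

text \<open>Both vectors represent the same linear functional, so their difference is orthogonal to
  itself.\<close>

lemma GDERIV_unique:
  assumes "GDERIV f x :> D" "GDERIV f x :> E"
  shows "D = E"
proof -
  have "(\<lambda>h. h \<bullet> D) = (\<lambda>h. h \<bullet> E)"
    using has_derivative_unique assms unfolding gderiv_def by blast
  then have "(D - E) \<bullet> D = (D - E) \<bullet> E" by meson
  then have "(D - E) \<bullet> (D - E) = 0" by (simp add: inner_diff_right)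
  then show ?thesis by simp
qed

lemma grad_eqI: "GDERIV f x :> D \<Longrightarrow> grad f x = D"
  unfolding grad_def using GDERIV_unique by blast

text \<open>In finite dimension the derivative is represented by the vector of its values on the
  basis. Differentiability alone thus gives \<open>grad\<close> its meaning.\<close>

lemma GDERIV_grad:
  fixes f :: "'a::euclidean_space \<Rightarrow> real"
  assumes "f differentiable (at x)"
  shows "GDERIV f x :> grad f x"
proof -
  obtain f' where f': "(f has_derivative f') (at x)"
    using assms by (auto simp: differentiable_def)
  then have lin: "linear f'" by (rule has_derivative_linear)
  have "f' v = v \<bullet> (\<Sum>b\<in>Basis. f' b *\<^sub>R b)" for v
  proof -
    have "f' v = f' (\<Sum>b\<in>Basis. (v \<bullet> b) *\<^sub>R b)" by (simp add: euclidean_representation)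
    also have "\<dots> = (\<Sum>b\<in>Basis. (v \<bullet> b) * f' b)"
      by (simp add: linear_sum[OF lin] linear_cmul[OF lin])
    finally show ?thesis by (simp add: inner_sum_right mult.commute)
  qed
  then have "f' = (\<lambda>v. v \<bullet> (\<Sum>b\<in>Basis. f' b *\<^sub>R b))" by blast
  with f' have "GDERIV f x :> (\<Sum>b\<in>Basis. f' b *\<^sub>R b)" by (simp add: gderiv_def)
  then show ?thesis using grad_eqI by metis
qed

text \<open>A quadratic remainder divided by \<open>norm (x - y)\<close> still tends to 0. This
  serves to differentiate an expectation whose remainder is bounded.\<close>

lemma GDERIV_quadratic_bound:
  fixes f :: "'a::real_inner \<Rightarrow> real"
  assumes "\<And>x. \<bar>f x - f y - D \<bullet> (x - y)\<bar> \<le> K * (norm (x - y))\<^sup>2"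
  shows "GDERIV f y :> D"
  unfolding gderiv_def has_derivative_iff_norm
proof (intro conjI)
  show "bounded_linear (\<lambda>h. h \<bullet> D)" by (rule bounded_linear_inner_left)
  show "((\<lambda>x. norm (f x - f y - (x - y) \<bullet> D) / norm (x - y)) \<longlongrightarrow> 0) (at y)"
  proof (rule Lim_null_comparison)
    show "\<forall>\<^sub>F x in at y. norm (norm (f x - f y - (x - y) \<bullet> D) / norm (x - y)) \<le> K * norm (x - y)"
      using assms
      by (auto simp: eventually_at_filter inner_commute divide_le_eq power2_eq_square mult.assoc)
    have "((\<lambda>x. K * norm (x - y)) \<longlongrightarrow> K * norm (y - y)) (at y)"
      by (intro tendsto_intros)
    then show "((\<lambda>x. K * norm (x - y)) \<longlongrightarrow> 0) (at y)" by simp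
  qed
qed

text \<open>Chain rule for an inner linear map, tested against a vector \<open>v\<close> so that the
  adjoint of \<open>T\<close> need not appear.\<close>

lemma
  fixes f :: "'a::euclidean_space \<Rightarrow> real" and T :: "'b::euclidean_space \<Rightarrow> 'a"
  assumes "f differentiable (at (T x))" and T: "bounded_linear T"
  shows differentiable_comp_linear: "(\<lambda>x. f (T x)) differentiable (at x)"
    and grad_comp_linear: "grad (\<lambda>x. f (T x)) x \<bullet> v = grad f (T x) \<bullet> T v"
proof -
  have f: "(f has_derivative (\<lambda>v. v \<bullet> grad f (T x))) (at (T x))"
    using GDERIV_grad[OF assms(1)] by (simp add: gderiv_def)
  have fT: "((\<lambda>x. f (T x)) has_derivative (\<lambda>v. T v \<bullet> grad f (T x))) (at x)"
    using has_derivative_compose[OF bounded_linear_imp_has_derivative[OF T] f] by simp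
  then show d: "(\<lambda>x. f (T x)) differentiable (at x)" by (auto simp: differentiable_def)
  have "(\<lambda>v. T v \<bullet> grad f (T x)) = (\<lambda>v. v \<bullet> grad (\<lambda>x. f (T x)) x)"
    using has_derivative_unique[OF fT] GDERIV_grad[OF d] by (simp add: gderiv_def)
  then show "grad (\<lambda>x. f (T x)) x \<bullet> v = grad f (T x) \<bullet> T v"
    by (metis inner_commute)
qed

section \<open>Consequences of smoothness and strong convexity\<close>

text \<open>The step of length \<open>1/K\<close> along the negative gradient minimises the
  quadratic upper model at \<open>x\<close>. The decrease that it guarantees cannot exceed
  \<open>f x - m\<close>, where \<open>m\<close> is any lower bound, attained or not.\<close>

lemma grad_norm_bound_smooth_with:
  fixes f :: "'a::real_inner \<Rightarrow> real"
  assumes "smooth_with K f" "0 < K" "\<And>x. m \<le> f x"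
  shows "(norm (grad f x))\<^sup>2 \<le> 2 * K * (f x - m)"
proof -
  define g where "g = grad f x"
  have "f (x - (1/K) *\<^sub>R g) - f x - g \<bullet> ((x - (1/K) *\<^sub>R g) - x)
      \<le> K / 2 * (norm ((x - (1/K) *\<^sub>R g) - x))\<^sup>2"
    using assms(1) unfolding smooth_with_def g_def by blast
  then have "f (x - (1/K) *\<^sub>R g) - f x + (norm g)\<^sup>2 / K \<le> (norm g)\<^sup>2 / (2 * K)"
    using \<open>0 < K\<close> by (simp add: power2_norm_eq_inner[symmetric] power_divide)
      (simp add: field_simps power2_eq_square)
  with assms(3)[of "x - (1/K) *\<^sub>R g"] have "(norm g)\<^sup>2 / K \<le> f x - m + (norm g)\<^sup>2 / (2 * K)"
    by linarith
  then show ?thesis using \<open>0 < K\<close> by (simp add: g_def field_simps)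
qed

text \<open>Continuity gives a minimiser on a compact ball; outside the ball the quadratic lower
  bound at 0 keeps \<open>f\<close> at or above \<open>f 0\<close>.\<close>

lemma strongly_convex_attains_min:
  fixes f :: "'a::euclidean_space \<Rightarrow> real"
  assumes "strongly_convex m f" "0 < m"
  obtains x where "\<And>y. f x \<le> f y"
proof -
  \<comment> \<open>Beyond this radius \<open>m / 2 * r * r\<close> dominates the linear term
    \<open>norm (grad f 0) * r\<close>.\<close>
  define R where "R = 2 * norm (grad f 0) / m"
  have "continuous_on (cball 0 R) f"
    using assms(1) unfolding strongly_convex_def
    by (meson continuous_at_imp_continuous_on differentiable_imp_continuous_within)
  moreover have "0 \<le> R" using \<open>0 < m\<close> by (simp add: R_def)
  ultimately obtain x where x: "\<And>y. y \<in> cball 0 R \<Longrightarrow> f x \<le> f y"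
    using continuous_attains_inf[of "cball 0 R" f] by fastforce
  have "f x \<le> f y" for y
  proof (cases "y \<in> cball 0 R")
    case False
    then have "m * norm y \<ge> 2 * norm (grad f 0)"
      using \<open>0 < m\<close> by (simp add: R_def field_simps)
    then have "m * norm y * norm y \<ge> 2 * norm (grad f 0) * norm y"
      by (simp add: mult_right_mono)
    moreover have "m / 2 * (norm (y - 0))\<^sup>2 \<le> f y - f 0 - grad f 0 \<bullet> (y - 0)"
      using assms(1) unfolding strongly_convex_def by blast
    moreover have "- (grad f 0 \<bullet> y) \<le> norm (grad f 0) * norm y"
      using Cauchy_Schwarz_ineq2[of "grad f 0" y] by linarith
    ultimately have "f 0 \<le> f y" by (simp add: power2_eq_square)
    with x[of 0] \<open>0 \<le> R\<close> show ?thesis by simp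
  qed (use x in simp)
  then show ?thesis using that by blast
qed

section \<open>Expectations of families with uniform quadratic bounds\<close>

text \<open>A directional derivative is the pointwise limit of a sequence of difference quotients,
  each measurable in \<open>z\<close>.\<close>

lemma borel_measurable_grad_inner:
  fixes g :: "'w::euclidean_space \<Rightarrow> 'z \<Rightarrow> real"
  assumes "\<And>w. g w \<in> borel_measurable M"
    and "\<And>z. z \<in> space M \<Longrightarrow> (\<lambda>v. g v z) differentiable (at w)"
  shows "(\<lambda>z. grad (\<lambda>v. g v z) w \<bullet> v) \<in> borel_measurable M"
proof (rule borel_measurable_LIMSEQ_real)
  \<comment> \<open>\<open>Suc n\<close> keeps every increment nonzero, so the limit at 0 can be
    taken along this sequence.\<close>
  let ?t = "\<lambda>n. inverse (real (Suc n))"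
  show "(\<lambda>z. (g (w + ?t n *\<^sub>R v) z - g w z) / ?t n) \<in> borel_measurable M" for n
    using assms(1) by measurable
  fix z assume "z \<in> space M"
  then have "((\<lambda>v. g v z) has_derivative (\<lambda>v. v \<bullet> grad (\<lambda>v. g v z) w)) (at (w + 0 *\<^sub>R v))"
    using GDERIV_grad[OF assms(2)] by (simp add: gderiv_def)
  moreover have "((\<lambda>t. w + t *\<^sub>R v) has_derivative (\<lambda>t. t *\<^sub>R v)) (at 0)"
    by (auto intro!: derivative_eq_intros)
  ultimately have
    "((\<lambda>t. g (w + t *\<^sub>R v) z) has_derivative (\<lambda>t. (t *\<^sub>R v) \<bullet> grad (\<lambda>v. g v z) w)) (at 0)"
    using has_derivative_compose by blast
  moreover have "(\<lambda>t. (t *\<^sub>R v) \<bullet> grad (\<lambda>v. g v z) w) = (*) (grad (\<lambda>v. g v z) w \<bullet> v)"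
    by (auto simp: inner_commute)
  ultimately have "((\<lambda>t. g (w + t *\<^sub>R v) z) has_real_derivative (grad (\<lambda>v. g v z) w \<bullet> v)) (at 0)"
    by (simp only: has_field_derivative_def)
  then have "(\<lambda>t. (g (w + t *\<^sub>R v) z - g w z) / t) \<midarrow>0\<rightarrow> grad (\<lambda>v. g v z) w \<bullet> v"
    by (simp add: DERIV_def)
  moreover have "filterlim ?t (at 0) sequentially"
    using LIMSEQ_inverse_real_of_nat by (simp add: filterlim_at)
  ultimately show "(\<lambda>n. (g (w + ?t n *\<^sub>R v) z - g w z) / ?t n) \<longlonglongrightarrow> grad (\<lambda>v. g v z) w \<bullet> v"
    by (rule filterlim_compose)
qed

lemma integrable_euclidean_componentwise:
  fixes f :: "'z \<Rightarrow> 'a::euclidean_space"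
  assumes "\<And>b. b \<in> Basis \<Longrightarrow> integrable M (\<lambda>z. f z \<bullet> b)"
  shows "integrable M f"
proof -
  have "integrable M (\<lambda>z. \<Sum>b\<in>Basis. (f z \<bullet> b) *\<^sub>R b)"
    using assms by (intro Bochner_Integration.integrable_sum integrable_scaleR_left)
  then show ?thesis by (simp add: euclidean_representation)
qed

text \<open>The remainder bound at \<open>x = w + v\<close> dominates the component along
  \<open>v\<close> by two integrable values of \<open>g\<close> and a constant.\<close>

lemma integrable_grad:
  fixes g :: "'w::euclidean_space \<Rightarrow> 'z \<Rightarrow> real"
  assumes "finite_measure M"
    and g: "\<And>w. integrable M (g w)"
    and d: "\<And>z. z \<in> space M \<Longrightarrow> (\<lambda>v. g v z) differentiable (at w)"
    and K: "\<And>z x. z \<in> space M \<Longrightarrow>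
      \<bar>g x z - g w z - grad (\<lambda>v. g v z) w \<bullet> (x - w)\<bar> \<le> K * (norm (x - w))\<^sup>2"
  shows "integrable M (\<lambda>z. grad (\<lambda>v. g v z) w)"
proof (rule integrable_euclidean_componentwise)
  interpret finite_measure M by fact
  fix v :: 'w
  show "integrable M (\<lambda>z. grad (\<lambda>v. g v z) w \<bullet> v)"
  proof (rule Bochner_Integration.integrable_bound)
    show "integrable M (\<lambda>z. \<bar>g (w + v) z\<bar> + \<bar>g w z\<bar> + K * (norm v)\<^sup>2)"
      using g by simp
    show "(\<lambda>z. grad (\<lambda>v. g v z) w \<bullet> v) \<in> borel_measurable M"
      using g d by (intro borel_measurable_grad_inner) auto
    show "AE z in M. norm (grad (\<lambda>v. g v z) w \<bullet> v) \<le> norm (\<bar>g (w + v) z\<bar> + \<bar>g w z\<bar> + K * (norm v)\<^sup>2)"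
    proof (rule AE_I2)
      fix z assume "z \<in> space M"
      from K[OF this, of "w + v"]
      show "norm (grad (\<lambda>v. g v z) w \<bullet> v) \<le> norm (\<bar>g (w + v) z\<bar> + \<bar>g w z\<bar> + K * (norm v)\<^sup>2)"
        by simp
    qed
  qed
qed

text \<open>Integrating the pointwise expansion leaves a remainder with the same quadratic bound, so
  the expected gradient is the gradient of the expectation. No separate interchange of limit and
  integral is made.\<close>

lemma
  fixes g :: "'w::euclidean_space \<Rightarrow> 'z \<Rightarrow> real"
  assumes "prob_space M"
    and g: "\<And>w. integrable M (g w)"
    and d: "\<And>z. z \<in> space M \<Longrightarrow> (\<lambda>v. g v z) differentiable (at w)"
    and K: "\<And>z x. z \<in> space M \<Longrightarrow>
      \<bar>g x z - g w z - grad (\<lambda>v. g v z) w \<bullet> (x - w)\<bar> \<le> K * (norm (x - w))\<^sup>2"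
  shows integrable_remainder:
      "integrable M (\<lambda>z. g x z - g w z - grad (\<lambda>v. g v z) w \<bullet> (x - w))"
    and differentiable_expected_obj: "expected_obj M g differentiable (at w)"
    and expected_obj_remainder:
      "expected_obj M g x - expected_obj M g w - grad (expected_obj M g) w \<bullet> (x - w)
        = (\<integral>z. g x z - g w z - grad (\<lambda>v. g v z) w \<bullet> (x - w) \<partial>M)"
proof -
  interpret prob_space M by fact
  have int: "integrable M (\<lambda>z. grad (\<lambda>v. g v z) w)"
    using g d K by (intro integrable_grad) (auto intro: finite_measure_axioms)
  let ?D = "\<integral>z. grad (\<lambda>v. g v z) w \<partial>M"
  let ?r = "\<lambda>x z. g x z - g w z - grad (\<lambda>v. g v z) w \<bullet> (x - w)"
  have r: "integrable M (?r x)" for x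
    using int g by (intro Bochner_Integration.integrable_diff integrable_inner_left) auto
  then show "integrable M (?r x)" .
  have eq: "expected_obj M g x - expected_obj M g w - ?D \<bullet> (x - w) = (\<integral>z. ?r x z \<partial>M)" for x
    using int g by (simp add: expected_obj_def)
  have "\<bar>\<integral>z. ?r x z \<partial>M\<bar> \<le> K * (norm (x - w))\<^sup>2" for x
  proof -
    have "\<bar>\<integral>z. ?r x z \<partial>M\<bar> \<le> (\<integral>z. \<bar>?r x z\<bar> \<partial>M)" by (rule integral_abs_bound)
    also have "\<dots> \<le> K * (norm (x - w))\<^sup>2"
      using r K by (intro integral_le_const) auto
    finally show ?thesis .
  qed
  then have D: "GDERIV (expected_obj M g) w :> ?D"
    by (intro GDERIV_quadratic_bound) (simp add: eq)
  then show "expected_obj M g differentiable (at w)"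
    by (auto simp: gderiv_def differentiable_def)
  show "expected_obj M g x - expected_obj M g w - grad (expected_obj M g) w \<bullet> (x - w)
      = (\<integral>z. ?r x z \<partial>M)"
    using eq grad_eqI[OF D] by simp
qed

section \<open>Extremal eigenvalues of symmetric matrices\<close>

lemma symmetric_matrix_inner:
  fixes A :: "real^'n^'n"
  assumes "transpose A = A"
  shows "x \<bullet> (A *v y) = (A *v x) \<bullet> y"
  by (metis assms dot_lmul_matrix transpose_matrix_vector)

text \<open>Eigenvectors of distinct eigenvalues are orthogonal, hence independent. Finiteness is
  what lets \<open>Max\<close> and \<open>Min\<close> act as true extrema.\<close>

lemma finite_eigenvals:
  fixes A :: "real^'n^'n"
  assumes "transpose A = A"
  shows "finite (eigenvals A)"
proof -
  define v where "v k = (SOME v. v \<noteq> 0 \<and> A *v v = k *\<^sub>R v)" for k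
  have v: "v k \<noteq> 0 \<and> A *v v k = k *\<^sub>R v k" if "k \<in> eigenvals A" for k
    using that unfolding v_def eigenvals_def mem_Collect_eq by (rule someI_ex)
  have orth: "v j \<bullet> v k = 0" if "j \<in> eigenvals A" "k \<in> eigenvals A" "j \<noteq> k" for j k
    using symmetric_matrix_inner[OF assms, of "v j" "v k"] v that by simp
  have "pairwise orthogonal (v ` eigenvals A)"
    by (auto simp: pairwise_def orthogonal_def) (metis orth)
  then have "independent (v ` eigenvals A)"
    using v by (intro pairwise_orthogonal_independent) auto
  then have "finite (v ` eigenvals A)" by (rule independent_imp_finite)
  moreover have "inj_on v (eigenvals A)"
    by (intro inj_onI) (metis orth v inner_eq_zero_iff)
  ultimately show ?thesis using finite_imageD by blast
qed

text \<open>The maximum \<open>m\<close> of the Rayleigh quotient is an eigenvalue: \<open>m I - A\<close> is positive semidefinite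
  and its quadratic form vanishes at the maximiser, which therefore lies in its kernel.\<close>

lemma eigenvalue_ge_quadratic_form:
  fixes A :: "real^'n^'n"
  assumes sym: "transpose A = A"
  obtains k where "k \<in> eigenvals A" "\<And>v. v \<bullet> (A *v v) \<le> k * (norm v)\<^sup>2"
proof -
  have "continuous_on (sphere 0 1) (\<lambda>v. v \<bullet> (A *v v))"
    by (intro continuous_intros linear_continuous_on) (simp add: matrix_vector_mul_bounded_linear)
  moreover have "axis undefined 1 \<in> sphere (0::real^'n) 1" by (simp add: norm_axis_1)
  ultimately obtain u where u: "norm u = 1"
    and max: "\<And>v. norm v = 1 \<Longrightarrow> v \<bullet> (A *v v) \<le> u \<bullet> (A *v u)"
    using continuous_attains_sup[of "sphere (0::real^'n) 1" "\<lambda>v. v \<bullet> (A *v v)"] by auto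
  define m where "m = u \<bullet> (A *v u)"
  have bound: "v \<bullet> (A *v v) \<le> m * (norm v)\<^sup>2" for v
  proof (cases "v = 0")
    case False
    have "norm ((1 / norm v) *\<^sub>R v) = 1" using False by simp
    from max[OF this] have "v \<bullet> (A *v v) / (norm v * norm v) \<le> m"
      by (simp add: m_def matrix_vector_mult_scaleR)
    with False show ?thesis by (simp add: divide_le_eq power2_eq_square split: if_splits)
  qed simp
  \<comment> \<open>The residual of the eigenvalue equation at the maximiser; the goal is to show
    that it is 0.\<close>
  define w where "w = m *\<^sub>R u - A *v u"
  define q where "q = m * (norm w)\<^sup>2 - w \<bullet> (A *v w)"
  \<comment> \<open>The form of \<open>m I - A\<close> at \<open>u + t *\<^sub>R w\<close>. Its
    constant term vanishes, and its linear coefficient is positive unless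
    \<open>w = 0\<close>.\<close>
  have nonneg: "0 \<le> 2 * t * (norm w)\<^sup>2 + t\<^sup>2 * q" for t
  proof -
    have "(u + t *\<^sub>R w) \<bullet> (A *v (u + t *\<^sub>R w)) = m + 2 * t * (w \<bullet> (A *v u)) + t\<^sup>2 * (w \<bullet> (A *v w))"
      using symmetric_matrix_inner[OF sym, of u w]
      by (simp add: matrix_vector_right_distrib matrix_vector_mult_scaleR inner_add_left
          inner_add_right m_def inner_commute power2_eq_square algebra_simps)
    moreover have "(norm (u + t *\<^sub>R w))\<^sup>2 = 1 + 2 * t * (w \<bullet> u) + t\<^sup>2 * (norm w)\<^sup>2"
      using u unfolding power2_norm_eq_inner norm_eq_1
      by (simp add: inner_add_left inner_add_right inner_commute[of u w] power2_eq_square algebra_simps)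
    ultimately have "0 \<le> 2 * t * (m * (w \<bullet> u) - w \<bullet> (A *v u)) + t\<^sup>2 * q"
      using bound[of "u + t *\<^sub>R w"] by (simp add: q_def algebra_simps)
    moreover have "m * (w \<bullet> u) - w \<bullet> (A *v u) = (norm w)\<^sup>2"
      by (simp add: w_def power2_norm_eq_inner inner_diff_right)
    ultimately show ?thesis by simp
  qed
  \<comment> \<open>At \<open>t = - s\<close> the quadratic term is at most half of the linear one
    in size; the summand 1 keeps the denominator positive.\<close>
  define s where "s = (norm w)\<^sup>2 / (1 + \<bar>q\<bar>)"
  have s: "s * (1 + \<bar>q\<bar>) = (norm w)\<^sup>2" by (simp add: s_def)
  have "s\<^sup>2 * q \<le> s\<^sup>2 * (1 + \<bar>q\<bar>)" by (intro mult_left_mono) auto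
  also have "\<dots> = s * (norm w)\<^sup>2" by (simp only: power2_eq_square[of s] mult.assoc s)
  finally have "s * (norm w)\<^sup>2 \<le> 0" using nonneg[of "- s"] by simp
  moreover have "0 < s * (norm w)\<^sup>2" if "w \<noteq> 0"
    using that unfolding s_def by (intro mult_pos_pos divide_pos_pos) auto
  ultimately have "w = 0" by fastforce
  then have "A *v u = m *\<^sub>R u" "u \<noteq> 0" using u by (auto simp: w_def)
  then have "m \<in> eigenvals A" unfolding eigenvals_def by blast
  with bound show ?thesis using that by blast
qed

lemma quadratic_form_le_sigma_max:
  fixes A :: "real^'n^'n"
  assumes "transpose A = A"
  shows "v \<bullet> (A *v v) \<le> sigma_max A * (norm v)\<^sup>2"
proof -
  obtain k where k: "k \<in> eigenvals A" "v \<bullet> (A *v v) \<le> k * (norm v)\<^sup>2"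
    using eigenvalue_ge_quadratic_form[OF assms] by blast
  then have "k \<le> sigma_max A"
    using finite_eigenvals[OF assms] by (simp add: sigma_max_def)
  then have "k * (norm v)\<^sup>2 \<le> sigma_max A * (norm v)\<^sup>2" by (rule mult_right_mono) simp
  with k show ?thesis by linarith
qed

text \<open>The upper estimate is applied to \<open>- A\<close>, whose eigenvalues are the negatives
  of those of \<open>A\<close>. It also yields an eigenvalue, so that \<open>Min\<close> ranges over
  a nonempty set.\<close>

lemma
  fixes A :: "real^'n^'n"
  assumes sym: "transpose A = A"
  shows sigma_min_le_quadratic_form: "sigma_min A * (norm v)\<^sup>2 \<le> v \<bullet> (A *v v)"
    and sigma_min_eigenval: "sigma_min A \<in> eigenvals A"
proof -
  have neg: "(- A) *v x = - (A *v x)" for x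
    by (metis diff_0 matrix_vector_mult_0 matrix_vector_mult_diff_rdistrib)
  have "transpose (- A) = - A"
    using sym by (simp add: transpose_def vec_eq_iff)
  then obtain k where "k \<in> eigenvals (- A)"
    and k: "\<And>v. v \<bullet> ((- A) *v v) \<le> k * (norm v)\<^sup>2"
    using eigenvalue_ge_quadratic_form by blast
  then have k': "- k \<in> eigenvals A"
    by (auto simp: eigenvals_def neg) (metis minus_equation_iff)
  then show "sigma_min A \<in> eigenvals A"
    unfolding sigma_min_def using finite_eigenvals[OF sym] by (intro Min_in) auto
  have "sigma_min A \<le> - k"
    unfolding sigma_min_def using finite_eigenvals[OF sym] k' by (rule Min_le)
  then have "sigma_min A * (norm v)\<^sup>2 \<le> - k * (norm v)\<^sup>2" by (rule mult_right_mono) simp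
  with k[of v] show "sigma_min A * (norm v)\<^sup>2 \<le> v \<bullet> (A *v v)" by (simp add: neg)
qed

section \<open>Gram matrices\<close>

lemma gram_nth: "gram \<phi> l $ i $ j = \<phi> i l \<bullet> \<phi> j l"
  by (simp add: gram_def basis_matrix_def matrix_matrix_mult_def transpose_def inner_vec_def)

lemma transpose_gram: "transpose (gram \<phi> l) = gram \<phi> l"
  by (simp add: vec_eq_iff transpose_def gram_nth inner_commute)

lemma gram_quadratic_form: "v \<bullet> (gram \<phi> l *v v) = (norm (basis_matrix \<phi> l *v v))\<^sup>2"
  unfolding gram_def power2_norm_eq_inner
  by (metis dot_lmul_matrix inner_commute matrix_vector_mul_assoc transpose_matrix_vector)

text \<open>The quadratic form of the Gram matrix is this squared norm; boundedness of the family
  makes the real supremum an upper bound.\<close>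

lemma norm_basis_matrix_le_C_const:
  assumes "bdd_above ((\<lambda>l. sigma_max (gram \<phi> l)) ` space P)" "l \<in> space P"
  shows "(norm (basis_matrix \<phi> l *v v))\<^sup>2 \<le> C_const P \<phi> * (norm v)\<^sup>2"
proof -
  have "(norm (basis_matrix \<phi> l *v v))\<^sup>2 \<le> sigma_max (gram \<phi> l) * (norm v)\<^sup>2"
    using quadratic_form_le_sigma_max[OF transpose_gram] by (simp add: gram_quadratic_form[symmetric])
  also have "\<dots> \<le> C_const P \<phi> * (norm v)\<^sup>2"
    unfolding C_const_def using assms by (intro mult_right_mono cSUP_upper) auto
  finally show ?thesis .
qed

lemma basis_matrix_axis: "basis_matrix \<phi> l *v axis j 1 = \<phi> j l"
  by (simp add: matrix_vector_mult_basis column_def basis_matrix_def vec_eq_iff)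

text \<open>Unit vectors bound each squared column norm by \<open>C_const P \<phi>\<close>.
  Cauchy-Schwarz and the arithmetic-geometric mean inequality carry this bound over to all
  entries.\<close>

lemma integrable_gram:
  fixes \<phi> :: "'p::finite \<Rightarrow> 'l \<Rightarrow> real^'d"
  assumes "finite_measure P" and \<phi>: "\<And>j. \<phi> j \<in> borel_measurable P"
    and bdd: "bdd_above ((\<lambda>l. sigma_max (gram \<phi> l)) ` space P)"
  shows "integrable P (gram \<phi>)"
proof (rule integrable_euclidean_componentwise)
  interpret finite_measure P by fact
  fix b :: "real^'p^'p" assume "b \<in> Basis"
  then obtain i j where b: "b = axis i (axis j 1)"
    by (auto simp: Basis_vec_def)
  have "integrable P (\<lambda>l. \<phi> i l \<bullet> \<phi> j l)"
  proof (rule integrable_const_bound)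
    show "AE l in P. norm (\<phi> i l \<bullet> \<phi> j l) \<le> C_const P \<phi>"
    proof (rule AE_I2)
      fix l assume l: "l \<in> space P"
      have "(norm (\<phi> i l))\<^sup>2 \<le> C_const P \<phi>" for i
        using norm_basis_matrix_le_C_const[OF bdd l, of "axis i 1"]
        by (simp add: basis_matrix_axis norm_axis_1)
      moreover have "2 * (norm (\<phi> i l) * norm (\<phi> j l)) \<le> (norm (\<phi> i l))\<^sup>2 + (norm (\<phi> j l))\<^sup>2"
        using sum_squares_bound[of "norm (\<phi> i l)" "norm (\<phi> j l)"] by simp
      moreover have "\<bar>\<phi> i l \<bullet> \<phi> j l\<bar> \<le> norm (\<phi> i l) * norm (\<phi> j l)" by (rule Cauchy_Schwarz_ineq2)
      ultimately show "norm (\<phi> i l \<bullet> \<phi> j l) \<le> C_const P \<phi>"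
        by (smt (verit) real_norm_def)
    qed
    show "(\<lambda>l. \<phi> i l \<bullet> \<phi> j l) \<in> borel_measurable P" using \<phi> by measurable
  qed
  then show "integrable P (\<lambda>l. gram \<phi> l \<bullet> b)" by (simp add: b inner_axis gram_nth)
qed

text \<open>The quadratic form at fixed \<open>v\<close> and transposition are both bounded linear
  in the matrix, so they commute with the integral.\<close>

lemma
  fixes \<phi> :: "'p::finite \<Rightarrow> 'l \<Rightarrow> real^'d"
  assumes int: "integrable P (gram \<phi>)"
  shows integrable_norm_basis_matrix: "integrable P (\<lambda>l. (norm (basis_matrix \<phi> l *v v))\<^sup>2)"
    and expected_gram_quadratic_form:
      "v \<bullet> ((\<integral>l. gram \<phi> l \<partial>P) *v v) = (\<integral>l. (norm (basis_matrix \<phi> l *v v))\<^sup>2 \<partial>P)"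
    and transpose_expected_gram: "transpose (\<integral>l. gram \<phi> l \<partial>P) = (\<integral>l. gram \<phi> l \<partial>P)"
proof -
  have lin: "bounded_linear (\<lambda>A::real^'p^'p. v \<bullet> (A *v v))"
    by (intro linear_conv_bounded_linear[THEN iffD1] linearI)
      (simp_all add: matrix_vector_mult_add_rdistrib inner_add_right scaleR_matrix_vector_assoc[symmetric])
  from integrable_bounded_linear[OF lin int]
  show "integrable P (\<lambda>l. (norm (basis_matrix \<phi> l *v v))\<^sup>2)" by (simp add: gram_quadratic_form)
  from integral_bounded_linear[OF lin int]
  show "v \<bullet> ((\<integral>l. gram \<phi> l \<partial>P) *v v) = (\<integral>l. (norm (basis_matrix \<phi> l *v v))\<^sup>2 \<partial>P)"
    by (simp add: gram_quadratic_form)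
  have "bounded_linear (transpose :: real^'p^'p \<Rightarrow> _)"
    by (intro linear_conv_bounded_linear[THEN iffD1] linearI) (simp_all add: transpose_def vec_eq_iff)
  from integral_bounded_linear[OF this int, unfolded transpose_gram]
  show "transpose (\<integral>l. gram \<phi> l \<partial>P) = (\<integral>l. gram \<phi> l \<partial>P)" by (rule sym)
qed

section \<open>The spectral constants: lower bound and positivity\<close>

lemma c_const_le_expected_norm:
  assumes "integrable P (gram \<phi>)"
  shows "c_const P \<phi> * (norm v)\<^sup>2 \<le> (\<integral>l. (norm (basis_matrix \<phi> l *v v))\<^sup>2 \<partial>P)"
  using sigma_min_le_quadratic_form[OF transpose_expected_gram[OF assms]]
  by (simp add: c_const_def expected_gram_quadratic_form[OF assms])

text \<open>At an eigenvector \<open>v\<close> of the smallest eigenvalue,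
  \<open>c_const P \<phi> * (norm v)\<^sup>2\<close> is the expectation of a nonnegative function.
  If it vanished, \<open>v\<close> would be annihilated almost everywhere.\<close>

lemma c_const_pos:
  fixes \<phi> :: "'p::finite \<Rightarrow> 'l \<Rightarrow> real^'d"
  assumes int: "integrable P (gram \<phi>)"
    and inj: "\<not> (\<exists>\<beta>. \<beta> \<noteq> 0 \<and> (AE l in P. basis_matrix \<phi> l *v \<beta> = 0))"
  shows "0 < c_const P \<phi>"
proof -
  obtain v where "v \<noteq> 0" and v: "(\<integral>l. gram \<phi> l \<partial>P) *v v = c_const P \<phi> *\<^sub>R v"
    using sigma_min_eigenval[OF transpose_expected_gram[OF int]]
    unfolding c_const_def eigenvals_def by blast
  have eq: "c_const P \<phi> * (norm v)\<^sup>2 = (\<integral>l. (norm (basis_matrix \<phi> l *v v))\<^sup>2 \<partial>P)"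
    using expected_gram_quadratic_form[OF int, of v] by (simp add: v power2_norm_eq_inner)
  have "(\<integral>l. (norm (basis_matrix \<phi> l *v v))\<^sup>2 \<partial>P) \<noteq> 0"
    using inj \<open>v \<noteq> 0\<close>
    by (subst integral_nonneg_eq_0_iff_AE[OF integrable_norm_basis_matrix[OF int]]) auto
  moreover have "(\<integral>l. (norm (basis_matrix \<phi> l *v v))\<^sup>2 \<partial>P) \<ge> 0" by simp
  ultimately have "0 < c_const P \<phi> * (norm v)\<^sup>2" using eq by linarith
  with \<open>v \<noteq> 0\<close> show ?thesis by (simp add: zero_less_mult_iff)
qed

text \<open>A nonpositive constant would annihilate a coordinate vector for every parameter.
  Positivity is needed for a gradient step of length \<open>1/K\<close>.\<close>

lemma C_const_pos:
  fixes \<phi> :: "'p::finite \<Rightarrow> 'l \<Rightarrow> real^'d"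
  assumes bdd: "bdd_above ((\<lambda>l. sigma_max (gram \<phi> l)) ` space P)"
    and inj: "\<not> (\<exists>\<beta>. \<beta> \<noteq> 0 \<and> (AE l in P. basis_matrix \<phi> l *v \<beta> = 0))"
  shows "0 < C_const P \<phi>"
proof (rule ccontr)
  assume C: "\<not> 0 < C_const P \<phi>"
  let ?\<beta> = "axis undefined 1 :: real^'p"
  have "basis_matrix \<phi> l *v ?\<beta> = 0" if "l \<in> space P" for l
    using norm_basis_matrix_le_C_const[OF bdd that, of ?\<beta>] C by (simp add: norm_axis_1)
      (smt (verit) norm_eq_zero power2_less_eq_zero_iff)
  then have "AE l in P. basis_matrix \<phi> l *v ?\<beta> = 0" by (rule AE_I2)
  moreover have "?\<beta> \<noteq> 0" by (simp add: axis_eq_0_iff)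
  ultimately show False using inj by blast
qed

section \<open>Growth condition and strong convexity of the expected objective\<close>

theorem lemma3p3:
  fixes P :: "'l measure"
    and h :: "real^'d \<Rightarrow> 'l \<Rightarrow> real"
    and \<theta>opt :: "'l \<Rightarrow> real^'d"
    and \<phi> :: "'p::finite \<Rightarrow> 'l \<Rightarrow> real^'d"
    and \<mu> L :: real
  assumes "prob_space P"
    and "\<And>l \<theta>. l \<in> space P \<Longrightarrow> h (\<theta>opt l) l \<le> h \<theta> l"
    and "\<And>j. \<phi> j \<in> borel_measurable P"
    and "\<And>\<beta>. integrable P (path_obj h \<phi> \<beta>)"
    and "bdd_above ((\<lambda>l. sigma_max (gram \<phi> l)) ` space P)"
    and "0 < \<mu>" and "\<mu> \<le> L"
    and "\<And>l. l \<in> space P \<Longrightarrow> strongly_convex \<mu> (\<lambda>\<theta>. h \<theta> l)"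
    and "\<And>l. l \<in> space P \<Longrightarrow> smooth_with L (\<lambda>\<theta>. h \<theta> l)"
    and "\<not> (\<exists>\<beta>. \<beta> \<noteq> 0 \<and> (AE l in P. basis_matrix \<phi> l *v \<beta> = 0))"
  shows "relaxed_weak_growth P (path_obj h \<phi>)
           (C_const P \<phi> * L) (ereal (2 * C_const P \<phi> * L) * eps_sp_opt P h \<theta>opt \<phi>)
         \<and> strongly_convex (c_const P \<phi> * \<mu>) (expected_obj P (path_obj h \<phi>))"
proof -
  interpret prob_space P by fact
  let ?f = "path_obj h \<phi>"
  let ?F = "expected_obj P ?f"
  let ?G = "\<lambda>l y. grad (\<lambda>v. ?f v l) y"
  let ?\<epsilon> = "eps_sp P h \<theta>opt \<phi>"
  define K where "K = C_const P \<phi> * L"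
  note f_int = assms(4) and bdd = assms(5)
  have "0 < L" using assms(6,7) by linarith
  then have K: "0 < K" unfolding K_def using C_const_pos[OF bdd assms(10)] by simp
  have gram: "integrable P (gram \<phi>)"
    using assms(3) bdd by (intro integrable_gram) (auto intro: finite_measure_axioms)
  have d: "(\<lambda>v. ?f v l) differentiable (at y)" if "l \<in> space P" for l y
    unfolding path_obj_def using assms(8)[OF that]
    by (intro differentiable_comp_linear[where f = "\<lambda>\<theta>. h \<theta> l" and T = "(*v) (basis_matrix \<phi> l)"])
      (auto simp: strongly_convex_def matrix_vector_mul_bounded_linear)
  have G: "?G l y \<bullet> v = grad (\<lambda>\<theta>. h \<theta> l) (basis_matrix \<phi> l *v y) \<bullet> (basis_matrix \<phi> l *v v)"
    if "l \<in> space P" for l y v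
    unfolding path_obj_def using assms(8)[OF that]
    by (intro grad_comp_linear[where f = "\<lambda>\<theta>. h \<theta> l" and T = "(*v) (basis_matrix \<phi> l)"])
      (auto simp: strongly_convex_def matrix_vector_mul_bounded_linear)
  \<comment> \<open>Curvature is kept in terms of the image of \<open>x - y\<close>: a single
    \<open>basis_matrix \<phi> l\<close> may have a kernel, and only the average over
    \<open>l\<close> is definite.\<close>
  have lower: "\<mu> / 2 * (norm (basis_matrix \<phi> l *v (x - y)))\<^sup>2 \<le> ?f x l - ?f y l - ?G l y \<bullet> (x - y)"
    if "l \<in> space P" for l x y
    using assms(8)[OF that] unfolding G[OF that]
    unfolding path_obj_def matrix_vector_mult_diff_distrib strongly_convex_def by blast
  have upper: "?f x l - ?f y l - ?G l y \<bullet> (x - y) \<le> K / 2 * (norm (x - y))\<^sup>2"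
    if "l \<in> space P" for l x y
  proof -
    have "?f x l - ?f y l - ?G l y \<bullet> (x - y) \<le> L / 2 * (norm (basis_matrix \<phi> l *v (x - y)))\<^sup>2"
      using assms(9)[OF that] unfolding G[OF that]
      unfolding path_obj_def matrix_vector_mult_diff_distrib smooth_with_def by blast
    also have "\<dots> \<le> L / 2 * (C_const P \<phi> * (norm (x - y))\<^sup>2)"
      using norm_basis_matrix_le_C_const[OF bdd that] \<open>0 < L\<close> by (intro mult_left_mono) auto
    finally show ?thesis by (simp add: K_def mult_ac)
  qed
  \<comment> \<open>The two-sided form that differentiation under the expectation requires; strong
    convexity makes the remainder nonnegative.\<close>
  have abs_bound: "\<bar>?f x l - ?f y l - ?G l y \<bullet> (x - y)\<bar> \<le> K / 2 * (norm (x - y))\<^sup>2"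
    if "l \<in> space P" for l x y
  proof -
    have "0 \<le> \<mu> / 2 * (norm (basis_matrix \<phi> l *v (x - y)))\<^sup>2" using assms(6) by simp
    with lower[OF that, of x y] upper[OF that, of x y] show ?thesis by linarith
  qed
  note F = differentiable_expected_obj[OF assms(1) f_int d abs_bound]
    expected_obj_remainder[OF assms(1) f_int d abs_bound]
    integrable_remainder[OF assms(1) f_int d abs_bound]

  have sc: "strongly_convex (c_const P \<phi> * \<mu>) ?F"
    unfolding strongly_convex_def
  proof (intro conjI allI)
    fix x y :: "real^'p"
    have "c_const P \<phi> * \<mu> / 2 * (norm (x - y))\<^sup>2 = \<mu> / 2 * (c_const P \<phi> * (norm (x - y))\<^sup>2)" by simp
    also have "\<dots> \<le> \<mu> / 2 * (\<integral>l. (norm (basis_matrix \<phi> l *v (x - y)))\<^sup>2 \<partial>P)"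
      using c_const_le_expected_norm[OF gram] assms(6) by (intro mult_left_mono) auto
    also have "\<dots> = (\<integral>l. \<mu> / 2 * (norm (basis_matrix \<phi> l *v (x - y)))\<^sup>2 \<partial>P)" by simp
    also have "\<dots> \<le> (\<integral>l. ?f x l - ?f y l - ?G l y \<bullet> (x - y) \<partial>P)"
      using lower integrable_norm_basis_matrix[OF gram] F(3)
      by (intro integral_mono) auto
    also have "\<dots> = ?F x - ?F y - grad ?F y \<bullet> (x - y)" by (rule F(2)[symmetric])
    finally show "c_const P \<phi> * \<mu> / 2 * (norm (x - y))\<^sup>2 \<le> ?F x - ?F y - grad ?F y \<bullet> (x - y)" .
  qed (rule F(1))

  \<comment> \<open>The reference value is the unconstrained optimum
    \<open>h (\<theta>opt l) l\<close>, which \<open>?f\<close> need not attain at any coefficient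
    vector.\<close>
  have grad_bound: "(norm (?G l w))\<^sup>2 \<le> 2 * K * (?f w l - h (\<theta>opt l) l)" if "l \<in> space P" for l w
  proof (rule grad_norm_bound_smooth_with)
    show "smooth_with K (\<lambda>v. ?f v l)"
      using d[OF that] upper[OF that] by (simp add: smooth_with_def)
  qed (use K assms(2)[OF that] in \<open>auto simp: path_obj_def\<close>)

  \<comment> \<open>A nonempty parameter set keeps the supremum in \<open>eps_sp\<close> from being
    that of the empty set, which is -\<infinity>.\<close>
  obtain l0 where l0: "l0 \<in> space P" using not_empty by blast
  have \<epsilon>_upper: "ereal (?f \<beta> l - h (\<theta>opt l) l) \<le> ?\<epsilon> \<beta>" if "l \<in> space P" for \<beta> l
    unfolding eps_sp_def path_obj_def using that by (rule SUP_upper)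
  have \<epsilon>_nonneg: "0 \<le> ?\<epsilon> \<beta>" for \<beta>
  proof -
    have "0 \<le> ereal (?f \<beta> l0 - h (\<theta>opt l0) l0)"
      using assms(2)[OF l0] by (simp add: path_obj_def)
    then show ?thesis using \<epsilon>_upper[OF l0] by (rule order_trans)
  qed
  have \<epsilon>opt_nonneg: "0 \<le> eps_sp_opt P h \<theta>opt \<phi>"
    unfolding eps_sp_opt_def using \<epsilon>_nonneg by (intro INF_greatest)

  obtain w0 where w0: "\<And>w. ?F w0 \<le> ?F w"
    using strongly_convex_attains_min[OF sc] c_const_pos[OF gram assms(10)] assms(6) by auto
  let ?I = "\<lambda>w. enn2ereal (\<integral>\<^sup>+ l. ennreal ((norm (?G l w))\<^sup>2) \<partial>P)"
  have growth: "?I w \<le> ereal (2 * K * (?F w - ?F w0)) + ereal (2 * K) * ?\<epsilon> \<beta>" for w \<beta>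
  \<comment> \<open>For infinite error the right-hand side is \<infinity>, because \<open>K\<close>
    is positive; only a finite error needs an argument.\<close>
  proof (cases "?\<epsilon> \<beta>")
    case (real e)
    \<comment> \<open>The optimal value is replaced by its lower estimate
      \<open>?f \<beta> l - e\<close>, which is integrable in \<open>l\<close>.\<close>
    let ?b = "\<lambda>l. 2 * K * (?f w l - ?f \<beta> l + e)"
    have le: "(norm (?G l w))\<^sup>2 \<le> ?b l" if "l \<in> space P" for l
    proof -
      have "?f \<beta> l - h (\<theta>opt l) l \<le> e" using \<epsilon>_upper[OF that, of \<beta>] real by simp
      then have "2 * K * (?f w l - h (\<theta>opt l) l) \<le> ?b l" using K by (intro mult_left_mono) auto
      with grad_bound[OF that, of w] show ?thesis by linarith
    qed
    \<comment> \<open>As a majorant of a square, \<open>?b\<close> is nonnegative, so its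
      nonnegative integral is its Bochner integral.\<close>
    have nonneg: "0 \<le> ?b l" if "l \<in> space P" for l
      using le[OF that] by (rule order_trans[OF zero_le_power2])
    have "(\<integral>\<^sup>+ l. ennreal ((norm (?G l w))\<^sup>2) \<partial>P) \<le> (\<integral>\<^sup>+ l. ennreal (?b l) \<partial>P)"
      using le by (intro nn_integral_mono ennreal_leI)
    also have "\<dots> = ennreal (\<integral>l. ?b l \<partial>P)"
      using nonneg f_int by (intro nn_integral_eq_integral) (auto intro: AE_I2)
    finally have "?I w \<le> enn2ereal (ennreal (\<integral>l. ?b l \<partial>P))" by (simp add: less_eq_ennreal.rep_eq)
    also have "\<dots> = ereal (\<integral>l. ?b l \<partial>P)"
      using nonneg by (intro enn2ereal_ennreal integral_nonneg_AE AE_I2)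
    also have "(\<integral>l. ?b l \<partial>P) = 2 * K * (?F w - ?F \<beta> + e)"
      using f_int by (simp add: expected_obj_def prob_space)
    also have "\<dots> \<le> 2 * K * (?F w - ?F w0 + e)"
      using K w0 by (intro mult_left_mono) auto
    finally show ?thesis by (simp add: real algebra_simps)
  qed (use K \<epsilon>_nonneg[of \<beta>] in auto)
  have "?I w \<le> ereal (2 * K * (?F w - ?F w0)) + ereal (2 * K) * eps_sp_opt P h \<theta>opt \<phi>" for w
  proof -
    let ?a = "ereal (2 * K * (?F w - ?F w0))"
    \<comment> \<open>The left-hand side is free of \<beta>. The infimum then passes through the
      finite summand and the positive finite factor, whether or not some errors are
      infinite.\<close>
    have "?I w \<le> (INF \<beta>. ?a + ereal (2 * K) * ?\<epsilon> \<beta>)"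
      using growth by (intro INF_greatest)
    also have "\<dots> = ?a + (INF \<beta>. ereal (2 * K) * ?\<epsilon> \<beta>)"
      using K \<epsilon>_nonneg by (intro INF_ereal_add_right) auto
    also have "(INF \<beta>. ereal (2 * K) * ?\<epsilon> \<beta>) = ereal (2 * K) * (INF \<beta>. ?\<epsilon> \<beta>)"
      using ereal_Inf_cmult[of "2 * K" "\<lambda>x. x \<in> range ?\<epsilon>"] K
      by (simp add: Setcompr_eq_image image_image)
    finally show ?thesis by (simp add: eps_sp_opt_def)
  qed
  moreover have "0 \<le> ereal (2 * K) * eps_sp_opt P h \<theta>opt \<phi>"
    using K \<epsilon>opt_nonneg by (intro ereal_0_le_mult) auto
  ultimately have "relaxed_weak_growth P ?f K (ereal (2 * K) * eps_sp_opt P h \<theta>opt \<phi>)"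
    unfolding relaxed_weak_growth_def using K w0 by auto
  with sc show ?thesis by (simp add: K_def mult.assoc)
qed

end
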